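(* For a growing self-avoiding walk (GSAW) on the bi-infinite ladder graph $L_\infty$, let $q_\ell$ be the probability that it terminates with length $\ell$ and let $r_w$ be the probability that it terminates with width $w$. Then, as formal power series, $$\sum_{\ell\ge 0}q_\ell x^\ell=\frac{x^5(4-x^3)}{3(x^2-2)^2(x^3-4x^2-4x+8)}$$ and $$\sum_{w\ge 0}r_w y^w=\frac{y^2(4-y^2)}{3(y-2)^2(y^2-8y+8)}.$$
   Context: $L_\infty$ is the graph with vertex set $\{(a,b): a\in\mathbb{Z},\ b\in\{1,2\}\}$, where $(a,b)$ and $(a',b')$ are adjacent iff ($b=b'$ and $|a-a'|=1$) or ($a=a'$ and $b\ne b'$). All starting vertices are equivalent by symmetry. A growing self-avoiding walk (GSAW) on a graph is the random process that starts at a given vertex and at each step moves to a vertex chosen uniformly at random among the neighbors of the current vertex that have not yet been visited; it terminates (is trapped) when the current vertex has no unvisited neighbor. The length of the walk is the number of steps taken. The width of the walk is the difference between the largest and smallest first coordinates ($x$-coordinates) of the vertices visited. *)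

theory Defs
  imports
    "HOL-Probability.Probability"
    "HOL-Computational_Algebra.Formal_Power_Series"
begin

definition ladder_verts :: "(int \<times> nat) set" where
  "ladder_verts = UNIV \<times> {1, 2}"

definition ladder_edges :: "((int \<times> nat) \<times> (int \<times> nat)) set" where
  "ladder_edges = {((a, b), (a', b')).
     (a, b) \<in> ladder_verts \<and> (a', b') \<in> ladder_verts \<and>
     (b = b' \<and> \<bar>a - a'\<bar> = 1 \<or> a = a' \<and> b \<noteq> b')}"

definition unvisited :: "('v \<times> 'v) set \<Rightarrow> 'v list \<Rightarrow> 'v set" where
  "unvisited E p = E `` {last p} - set p"

text \<open>
  The argument \<open>p\<close> is the nonempty list of all vertices visited so far, in chronological order.
  The result is the distribution of the trapped walk; as the least fixed point of this
  recursion, it is a subprobability whose missing mass is the probability that the walk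
  never terminates. The graph must be locally finite, as \<open>spmf_of_set\<close> of an infinite set
  is the null distribution.
\<close>

partial_function (spmf) gsaw_from :: "('v \<times> 'v) set \<Rightarrow> 'v list \<Rightarrow> 'v list spmf" where
  "gsaw_from E p =
     (if unvisited E p = {} then return_spmf p
      else bind_spmf (spmf_of_set (unvisited E p)) (\<lambda>v. gsaw_from E (p @ [v])))"

definition gsaw :: "('v \<times> 'v) set \<Rightarrow> 'v \<Rightarrow> 'v list spmf" where
  "gsaw E v = gsaw_from E [v]"

text \<open>The length of a walk is its number of steps, one less than its number of vertices.\<close>

definition walk_length :: "'v list \<Rightarrow> nat" where
  "walk_length p = length p - 1"

definition walk_width :: "(int \<times> nat) list \<Rightarrow> int" where
  "walk_width p = Max (fst ` set p) - Min (fst ` set p)"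

definition length_prob :: "int \<times> nat \<Rightarrow> nat \<Rightarrow> real" where
  "length_prob v l = measure (measure_spmf (gsaw ladder_edges v)) {p. walk_length p = l}"

definition width_prob :: "int \<times> nat \<Rightarrow> nat \<Rightarrow> real" where
  "width_prob v w = measure (measure_spmf (gsaw ladder_edges v)) {p. walk_width p = int w}"

end

theory Submission
  imports Defs
begin

text \<open>
  Both generating functions are specialisations of one. Give a walk the weight \<open>X\<close> for each
  step into a column not visited before and \<open>b = X ^ t\<close> for every other step. The visited
  columns form an interval, so the number of steps of the first kind is the width, and the
  exponent of the total weight is the width for \<open>t = 0\<close> and the length for \<open>t = 1\<close>. The
  expected weight of the trapped walk is computed for every \<open>t\<close>.

  What the walk can still do depends on very little of its past. When it enters a new column
  with a completely visited column at its back, everything behind is unreachable: it is at a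
  corner of an empty half ladder, and the expected weight \<open>C\<close> of its remaining steps is always
  the same. It then runs straight for some \<open>k \<ge> 0\<close> steps, each with probability \<open>1/2\<close>,
  and changes row. If it now goes forward, it is at a corner again. If it turns back, which is
  possible for \<open>k \<ge> 1\<close>, it must walk \<open>k\<close> steps along the lane between its own trail and
  the boundary, and is trapped at the end. Hence
  \<open>C = (b/2) X C + (\<Sum>k\<ge>1. (X/2)^k (b/2) (1/2) (X C + b^k))\<close>, and so
  \<open>C = X b\<^sup>2 (2 - X) / ((2 - X b) (8 - 4 X - 4 b X + b X\<^sup>2))\<close>.

  The start differs in one point only. The first run, to the left or to the right, has no wall
  behind it; a walk that turns back leaves its lane at the far end, next to the starting column,
  and is then at a corner facing the other direction. So the trapped end, of weight \<open>1\<close>, is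
  replaced by \<open>X C\<close>. If the first step changes row instead, the next one leads to a corner.
  This gives the generating function
  \<open>X\<^sup>2 b\<^sup>3 (4 - X\<^sup>2 b) / (3 (2 - X b)\<^sup>2 (8 - 4 X - 4 b X + b X\<^sup>2))\<close>.

  In the formal proof the list of situations is the inductive relation \<open>position\<close>, which attaches
  to each a closed-form power series, and lemma \<open>position_closed\<close> shows that these series
  satisfy the one-step recursion of the walk. Lemma \<open>walk_gf_unique\<close> turns this into the desired
  equality: a family of power series that satisfies the recursion is the family of generating
  functions, because a fixed coefficient only sees walks of bounded length.
\<close>

section \<open>Generating functions of growing self-avoiding walks\<close>

lemma gsaw_from_invariant:
  assumes "P p" and step: "\<And>p v. P p \<Longrightarrow> v \<in> unvisited E p \<Longrightarrow> P (p @ [v])"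
  shows "\<forall>q\<in>set_spmf (gsaw_from E p). P q"
  using assms(1)
proof (induction arbitrary: p rule: gsaw_from.fixp_induct)
  case 1
  then show ?case by simp
next
  case 2
  then show ?case by simp
next
  case (3 f)
  show ?case
  proof (cases "unvisited E p = {}")
    case True
    with 3(2) show ?thesis by simp
  next
    case False
    have "set_spmf (spmf_of_set (unvisited E p)) \<subseteq> unvisited E p"
      by (simp add: set_spmf_of_set)
    moreover have "\<forall>q\<in>set_spmf (f E (p @ [v])). P q" if "v \<in> unvisited E p" for v
      using 3(1) step[OF 3(2) that] by blast
    ultimately show ?thesis using False by (auto simp: set_bind_spmf bind_UNION)
  qed
qed

definition walk_gf :: "('v \<times> 'v) set \<Rightarrow> ('v list \<Rightarrow> nat) \<Rightarrow> 'v list \<Rightarrow> real fps" where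
  "walk_gf E f p = Abs_fps (\<lambda>n. spmf (map_spmf f (gsaw_from E p)) n)"

lemma walk_gf_trapped:
  assumes "unvisited E p = {}"
  shows "walk_gf E f p = fps_X ^ f p"
  using assms
  by (auto simp: walk_gf_def fps_eq_iff gsaw_from.simps[of E p] fps_X_power_nth indicator_def)

lemma walk_gf_step:
  assumes "unvisited E p \<noteq> {}" "finite (unvisited E p)"
  shows "of_nat (card (unvisited E p)) * walk_gf E f p = (\<Sum>v\<in>unvisited E p. walk_gf E f (p @ [v]))"
proof (rule fps_ext)
  fix n
  have "card (unvisited E p) > 0" using assms by (simp add: card_gt_0_iff)
  then show "fps_nth (of_nat (card (unvisited E p)) * walk_gf E f p) n
      = fps_nth (\<Sum>v\<in>unvisited E p. walk_gf E f (p @ [v])) n"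
    using assms
    by (simp add: walk_gf_def fps_sum_nth gsaw_from.simps[of E p] map_spmf_bind_spmf o_def
        spmf_bind integral_spmf_of_set fps_mult_of_nat_nth)
qed

text \<open>
  The one-step recursion alone does not single out the generating functions: their defining
  recursion is a least fixed point, and other solutions could hide mass at infinity. The bound
  \<open>B\<close> excludes this. Both sides have vanishing coefficient \<open>n\<close> once the walk is longer than
  \<open>B n\<close>, and the recursion, which lengthens the walk by one vertex, carries the equality of
  coefficients back to shorter walks. The relation \<open>R\<close> plays the part of a bisimulation.
\<close>

lemma walk_gf_unique:
  assumes trapped: "\<And>p F. R p F \<Longrightarrow> unvisited E p = {} \<Longrightarrow> F = fps_X ^ f p"
    and step: "\<And>p F. R p F \<Longrightarrow> unvisited E p \<noteq> {} \<Longrightarrow> finite (unvisited E p) \<and>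
      (\<exists>g. of_nat (card (unvisited E p)) * F = (\<Sum>v\<in>unvisited E p. g v) \<and>
           (\<forall>v\<in>unvisited E p. R (p @ [v]) (g v)))"
    and bound: "\<And>p F q. R p F \<Longrightarrow> q \<in> set_spmf (gsaw_from E p) \<Longrightarrow> length p \<le> B (f q)"
    and vanish: "\<And>p F n. R p F \<Longrightarrow> B n < length p \<Longrightarrow> fps_nth F n = 0"
    and "R p F"
  shows "walk_gf E f p = F"
proof (rule fps_ext)
  fix n
  show "fps_nth (walk_gf E f p) n = fps_nth F n"
    using \<open>R p F\<close>
  proof (induction "Suc (B n) - length p" arbitrary: p F rule: less_induct)
    case less
    consider "B n < length p" | "unvisited E p = {}" | "length p \<le> B n" "unvisited E p \<noteq> {}"
      by linarith
    then show ?case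
    proof cases
      case 1
      have "spmf (map_spmf f (gsaw_from E p)) n = 0"
        using bound[OF less.prems] 1 by (fastforce simp: spmf_eq_0_set_spmf)
      then show ?thesis using vanish[OF less.prems 1] by (simp add: walk_gf_def)
    next
      case 2
      then show ?thesis using trapped[OF less.prems] by (simp add: walk_gf_trapped)
    next
      case 3
      let ?U = "unvisited E p"
      from step[OF less.prems 3(2)] obtain g where fin: "finite ?U"
        and F: "of_nat (card ?U) * F = (\<Sum>v\<in>?U. g v)"
        and g: "\<And>v. v \<in> ?U \<Longrightarrow> R (p @ [v]) (g v)" by blast
      have "fps_nth (of_nat (card ?U) * walk_gf E f p) n
          = (\<Sum>v\<in>?U. fps_nth (walk_gf E f (p @ [v])) n)"
        using walk_gf_step[OF 3(2) fin] by (simp add: fps_sum_nth)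
      also have "\<dots> = (\<Sum>v\<in>?U. fps_nth (g v) n)"
        using less.hyps g 3(1) by (intro sum.cong) auto
      also have "\<dots> = fps_nth (of_nat (card ?U) * F) n" by (simp add: F fps_sum_nth)
      finally show ?thesis
        using 3(2) fin by (simp add: fps_mult_of_nat_nth)
    qed
  qed
qed

section \<open>Width and length as one statistic\<close>

text \<open>
  The first summand counts the steps into new columns, the second one is \<open>t\<close> times the number
  of the other steps.
\<close>

definition walk_weight :: "nat \<Rightarrow> (int \<times> nat) list \<Rightarrow> nat" where
  "walk_weight t p = (card (fst ` set p) - 1) + t * (length p - card (fst ` set p))"

lemma card_columns_le: "card (fst ` set p) \<le> length p"
  by (metis card_length le_trans card_image_le List.finite_set)

lemma walk_weight_snoc:
  assumes "p \<noteq> []"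
  shows "walk_weight t (p @ [v]) = walk_weight t p + (if fst v \<in> fst ` set p then t else 1)"
proof -
  have "card (fst ` set p) > 0" using assms by (simp add: card_gt_0_iff)
  then show ?thesis
    using card_columns_le[of p]
    by (auto simp: walk_weight_def Suc_diff_le card_insert_if image_iff)
qed

text \<open>
  Adjacency of consecutive vertices is replaced by its only consequence that matters here: the
  visited columns form an interval, so that counting columns measures the width.
\<close>

definition ladder_walk :: "(int \<times> nat) list \<Rightarrow> bool" where
  "ladder_walk p \<longleftrightarrow> p \<noteq> [] \<and> distinct p \<and> set p \<subseteq> ladder_verts \<and>
     (\<exists>m M. m \<le> M \<and> fst ` set p = {m..M})"

lemma ladder_walk_singleton: "v \<in> ladder_verts \<Longrightarrow> ladder_walk [v]"
  unfolding ladder_walk_def by (auto intro!: exI[of _ "fst v"])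

lemma ladder_walk_snoc:
  assumes "ladder_walk p" "v \<in> unvisited ladder_edges p"
  shows "ladder_walk (p @ [v])"
proof -
  from assms(1) obtain m M where mM: "m \<le> M" "fst ` set p = {m..M}" and p: "p \<noteq> []"
    by (auto simp: ladder_walk_def)
  have v: "v \<in> ladder_verts" "v \<notin> set p" "\<bar>fst v - fst (last p)\<bar> \<le> 1"
    using assms(2) by (auto simp: unvisited_def ladder_edges_def)
  have "fst (last p) \<in> {m..M}" using mM p by (metis image_eqI last_in_set)
  with v have "fst v \<in> {m - 1..M + 1}" by auto
  then consider "fst v = m - 1" | "fst v \<in> {m..M}" | "fst v = M + 1" by force
  then have "\<exists>m' M'. m' \<le> M' \<and> insert (fst v) {m..M} = {m'..M'}"
  proof cases
    case 1 with mM show ?thesis by (intro exI[of _ "m - 1"] exI[of _ M]) auto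
  next
    case 2 with mM show ?thesis by (intro exI[of _ m] exI[of _ M]) auto
  next
    case 3 with mM show ?thesis by (intro exI[of _ m] exI[of _ "M + 1"]) auto
  qed
  then show ?thesis using assms(1) v mM by (auto simp: ladder_walk_def)
qed

text \<open>
  A column has only two vertices. This gives the bound of lemma \<open>walk_gf_unique\<close>, even for
  \<open>t = 0\<close>, where steps inside old columns have weight \<open>1\<close>.
\<close>

lemma ladder_walk_length_le:
  assumes "ladder_walk p"
  shows "length p \<le> 2 * walk_weight t p + 2"
proof -
  have "set p \<subseteq> fst ` set p \<times> {1, 2}"
    using assms by (force simp: ladder_walk_def ladder_verts_def)
  then have "card (set p) \<le> card (fst ` set p \<times> {1, 2::nat})" by (intro card_mono) auto
  then have "length p \<le> 2 * card (fst ` set p)"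
    using assms by (simp add: ladder_walk_def distinct_card card_cartesian_product)
  then show ?thesis by (simp add: walk_weight_def)
qed

lemma walk_weight_0: "ladder_walk p \<Longrightarrow> walk_width p = int (walk_weight 0 p)"
proof -
  have "Max {m..M} = M" "Min {m..M} = m" if "m \<le> M" for m M :: int
    using that by (auto intro: Max_eqI Min_eqI)
  then show "ladder_walk p \<Longrightarrow> walk_width p = int (walk_weight 0 p)"
    by (auto simp: ladder_walk_def walk_width_def walk_weight_def)
qed

lemma walk_weight_1: "ladder_walk p \<Longrightarrow> walk_length p = walk_weight 1 p"
  using card_columns_le[of p]
  by (auto simp: ladder_walk_def walk_length_def walk_weight_def Suc_le_eq card_gt_0_iff)

section \<open>Closed forms for the remaining weight\<close>

text \<open>
  The first series is the factor that the denominators of the closed forms share. Each of the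
  others is the expected weight of the remaining steps in one situation. There \<open>k\<close> is the length
  of the lane behind the walk, and \<open>walled\<close> tells whether this lane is a dead end.
\<close>

definition denom_gf :: "nat \<Rightarrow> real fps" where
  "denom_gf t = 8 - 4 * fps_X - 4 * fps_X ^ t * fps_X + fps_X ^ t * fps_X ^ 2"

text \<open>The factor \<open>2\<close> compensates for \<open>4 - 2 X b\<close> in the place of \<open>2 - X b\<close>.\<close>

definition corner_gf :: "nat \<Rightarrow> real fps" where
  "corner_gf t = 2 * fps_X * (fps_X ^ t) ^ 2 * (2 - fps_X)
     * inverse (4 - 2 * fps_X * fps_X ^ t) * inverse (denom_gf t)"

text \<open>
  The weight that remains at the far end of the lane: the walk is trapped there, or it leaves
  into an empty half ladder.
\<close>

definition far_gf :: "nat \<Rightarrow> bool \<Rightarrow> real fps" where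
  "far_gf t walled = (if walled then 1 else fps_X * corner_gf t)"

text \<open>
  In a turn the walk has just changed row and chooses between going forward to a corner and going
  back through the lane. For a dead end of length \<open>0\<close> there is no way back.
\<close>

definition turn_gf :: "nat \<Rightarrow> bool \<Rightarrow> nat \<Rightarrow> real fps" where
  "turn_gf t walled k = (if walled \<and> k = 0 then fps_X * corner_gf t
     else fps_const (1 / 2) * (fps_X * corner_gf t + far_gf t walled * (fps_X ^ t) ^ k))"

text \<open>
  For \<open>k > 0\<close> this is the sum of the geometric series
  \<open>\<Sum>j. (X/2)^j (b/2) turn_gf t walled (k + j)\<close>, where \<open>j\<close> is the number of further
  straight steps. A run with \<open>k = 0\<close> is a corner.
\<close>

definition run_gf :: "nat \<Rightarrow> bool \<Rightarrow> nat \<Rightarrow> real fps" where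
  "run_gf t walled k = (if k = 0 then corner_gf t
     else fps_X ^ t * (fps_X * corner_gf t * inverse (4 - 2 * fps_X)
       + far_gf t walled * (fps_X ^ t) ^ k * inverse (4 - 2 * fps_X * fps_X ^ t)))"

definition start_gf :: "nat \<Rightarrow> real fps" where
  "start_gf t = fps_const (1 / 3) * (fps_X ^ t * fps_X * corner_gf t + 2 * (fps_X * run_gf t False 1))"

text \<open>All three series have a nonzero constant term, whatever \<open>t\<close> is.\<close>

lemma denominator_inverses:
  "inverse (4 - 2 * fps_X :: real fps) * (4 - 2 * fps_X) = 1"
  "inverse (4 - 2 * fps_X * fps_X ^ t :: real fps) * (4 - 2 * fps_X * fps_X ^ t) = 1"
  "inverse (denom_gf t) * denom_gf t = 1"
  by (rule inverse_mult_eq_1; simp add: denom_gf_def fps_numeral_nth)+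

lemma two_half: "2 * (fps_const (1 / 2) * F) = (F :: real fps)"
proof -
  have "2 * fps_const (1 / 2 :: real) = 1" by (simp add: numeral_fps_const)
  then show ?thesis by (metis mult.assoc mult_1)
qed

lemma turn_gf_rec:
  "\<not> (walled \<and> k = 0) \<Longrightarrow>
    2 * turn_gf t walled k = fps_X * corner_gf t + far_gf t walled * (fps_X ^ t) ^ k"
  by (auto simp: turn_gf_def two_half)

text \<open>
  The next two lemmas and \<open>start_equation\<close> below are the algebra behind the closed forms, in an
  arbitrary integral domain with \<open>x\<close> for \<open>X\<close> and with \<open>u\<close>, \<open>w\<close>, \<open>z\<close> for the inverses of the
  three denominators. Here \<open>c\<close> is the weight at a corner, and the equation is the recursion of a
  run of length \<open>0\<close>.
\<close>

lemma corner_equation: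
  fixes b x :: "'a::idom"
  assumes u: "u*(4-2*x) = 1" and z: "z*(8-4*x-4*b*x+b*x^2) = 1"
    and c: "c = 2*x*b^2*(2-x)*w*z"
  shows "2*c = x*(b*(x*c*u+b*w)) + b*(x*c)"
proof -
  have cu: "c*u = x*b^2*w*z"
  proof -
    have "c*u = x*b^2*w*z*(u*(4-2*x))" unfolding c by (simp add: algebra_simps)
    then show ?thesis using u by simp
  qed
  have "b*b*w*x = x*b^2*w*(z*(8-4*x-4*b*x+b*x^2))" using z by (simp add: power2_eq_square)
  then show ?thesis
    using arg_cong[OF cu, of "\<lambda>y. x*x*b*y"]  unfolding c
    by (simp add: algebra_simps power2_eq_square)
qed

lemma run_equation:
  fixes b x :: "'a::idom"
  assumes u: "u*(4-2*x) = 1" and w: "w*(4-2*x*b) = 1" and h: "2 * h = 1"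
  shows "2*(b*(x*c*u+e*b^k*w)) = x*(b*(x*c*u+e*b^Suc k*w)) + b*(h*(x*c+e*b^k))"
proof -
  have "(2 * h) * (u * (2 - x)) = h * (u * (4 - 2 * x))" by (simp add: algebra_simps)
  then have "u * (2 - x) = h" using h u by simp
  then have u2: "2 * u = x * u + h" by (simp add: algebra_simps)
  have "(2 * h) * (w * (2 - x * b)) = h * (w * (4 - 2 * x * b))" by (simp add: algebra_simps)
  then have "w * (2 - x * b) = h" using h w by simp
  then have w2: "2 * w = x * b * w + h" by (simp add: algebra_simps)
  have "2*(b*(x*c*u+e*b^k*w)) = b*(x*c*(2*u)+e*b^k*(2*w))" by (simp add: algebra_simps)
  then show ?thesis unfolding u2 w2 by (simp add: algebra_simps)
qed

lemma start_gf_rec: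
  "3 * start_gf t = fps_X ^ t * fps_X * corner_gf t + 2 * (fps_X * run_gf t False 1)"
proof -
  have "3 * fps_const (1 / 3 :: real) = 1" by (simp add: numeral_fps_const)
  then show ?thesis unfolding start_gf_def by (metis mult.assoc mult_1)
qed

lemma run_gf_rec:
  assumes "walled \<or> k > 0"
  shows "2 * run_gf t walled k = fps_X * run_gf t walled (Suc k) + fps_X ^ t * turn_gf t walled k"
proof (cases "k = 0")
  case True
  with assms have walled by simp
  with True show ?thesis
    using corner_equation[of "inverse (4 - 2 * fps_X)" fps_X "inverse (denom_gf t)" "fps_X ^ t"
        "corner_gf t",
        OF denominator_inverses(1) _ corner_gf_def] denominator_inverses(3)[of t]
    by (simp add: run_gf_def turn_gf_def far_gf_def denom_gf_def[of t])
next
  case False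
  have "2 * fps_const (1 / 2 :: real) = 1" by (simp add: numeral_fps_const)
  from run_equation[OF denominator_inverses(1) denominator_inverses(2)[of t] this,
      where c = "corner_gf t" and e = "far_gf t walled" and k = k] False
  show ?thesis by (simp add: run_gf_def turn_gf_def)
qed

section \<open>The situations of the walk\<close>

text \<open>
  In this section \<open>V\<close> is the set of visited vertices, the walk is in column \<open>c\<close> and row \<open>r\<close>,
  \<open>3 - r\<close> is the other row, and the sign \<open>s\<close> is the direction called forward. Distances are
  measured as \<open>s * (x - c)\<close>, so that left and right need not be treated separately.
\<close>

definition ahead_free :: "(int \<times> nat) set \<Rightarrow> int \<Rightarrow> int \<Rightarrow> bool" where
  "ahead_free V s c \<longleftrightarrow> (\<forall>x \<rho>. s * (x - c) > 0 \<longrightarrow> (x, \<rho>) \<notin> V)"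

text \<open>
  Behind column \<open>c\<close> there are \<open>k\<close> free cells in row \<open>r\<close>, alongside visited ones in the other row.
  Beyond them either the next column is completely visited, or all columns are empty.
\<close>

definition lane :: "(int \<times> nat) set \<Rightarrow> int \<Rightarrow> int \<Rightarrow> nat \<Rightarrow> nat \<Rightarrow> bool \<Rightarrow> bool" where
  "lane V s c r k walled \<longleftrightarrow>
     (\<forall>x. 0 < s * (c - x) \<and> s * (c - x) \<le> int k \<longrightarrow> (x, r) \<notin> V \<and> (x, 3 - r) \<in> V) \<and>
     (if walled then (c - s * (int k + 1), r) \<in> V \<and> (c - s * (int k + 1), 3 - r) \<in> V
      else (\<forall>x \<rho>. s * (c - x) > int k \<longrightarrow> (x, \<rho>) \<notin> V))"

lemma ladder_nbrs:
  assumes "s \<in> {1, -1}" "r \<in> {1, 2}"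
  shows "ladder_edges `` {(c, r)} = {(c + s, r), (c - s, r), (c, 3 - r)}"
  using assms by (auto simp: ladder_edges_def ladder_verts_def)

text \<open>
  The relation \<open>position t V u G\<close> says that \<open>G\<close> is the expected weight of the remaining steps if
  \<open>V\<close> is visited and \<open>u\<close> is the current vertex. While the walk runs in row \<open>r\<close>, the lane lies in
  the other row; in a turn and on the way back it lies in the row of the walk. An open lane of
  length \<open>0\<close> occurs in a turn, when the first step has changed row, but in a run it would be the
  start itself, which has a third neighbour; the last premise of \<open>running\<close> excludes it.
\<close>

inductive position :: "nat \<Rightarrow> (int \<times> nat) set \<Rightarrow> int \<times> nat \<Rightarrow> real fps \<Rightarrow> bool" for t where
  starting: "r \<in> {1, 2} \<Longrightarrow> position t {(c, r)} (c, r) (start_gf t)"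
| running: "\<lbrakk>s \<in> {1, -1}; r \<in> {1, 2}; (c, r) \<in> V; (c, 3 - r) \<notin> V; ahead_free V s c;
         lane V s c (3 - r) k walled; walled \<or> k > 0\<rbrakk>
        \<Longrightarrow> position t V (c, r) (run_gf t walled k)"
| turning: "\<lbrakk>s \<in> {1, -1}; r \<in> {1, 2}; (c, r) \<in> V; (c, 3 - r) \<in> V; ahead_free V s c;
         lane V s c r k walled\<rbrakk>
        \<Longrightarrow> position t V (c, r) (turn_gf t walled k)"
| retreating: "\<lbrakk>s \<in> {1, -1}; r \<in> {1, 2}; (c, r) \<in> V; (c, 3 - r) \<in> V; (c + s, r) \<in> V;
         lane V s c r k walled\<rbrakk>
        \<Longrightarrow> position t V (c, r) (far_gf t walled * (fps_X ^ t) ^ k)"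

definition step_gf :: "nat \<Rightarrow> (int \<times> nat) set \<Rightarrow> int \<times> nat \<Rightarrow> real fps" where
  "step_gf t V v = fps_X ^ (if fst v \<in> fst ` V then t else 1)"

text \<open>
  Going forward after a turn leaves a completely visited column behind, hence leads to a corner,
  that is, a run with a walled lane of length \<open>0\<close>.
\<close>

lemma turn_forward:
  assumes "s \<in> {1, -1}" "r \<in> {1, 2}" "(c, r) \<in> V" "(c, 3 - r) \<in> V" "ahead_free V s c"
  shows "position t (insert (c + s, r) V) (c + s, r) (corner_gf t)"
    and "step_gf t V (c + s, r) = fps_X"
    and "(c + s, r) \<notin> V"
proof -
  have "ahead_free (insert (c + s, r) V) s (c + s)" "(c + s, 3 - r) \<notin> insert (c + s, r) V"
    "lane (insert (c + s, r) V) s (c + s) (3 - r) 0 True"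
    using assms by (auto simp: ahead_free_def lane_def)
  from running[OF assms(1,2) _ this(2,1,3)]
  show "position t (insert (c + s, r) V) (c + s, r) (corner_gf t)" by (simp add: run_gf_def)
  have "c + s \<notin> fst ` V" using assms(1,5) by (auto simp: ahead_free_def)
  then show "step_gf t V (c + s, r) = fps_X" "(c + s, r) \<notin> V"
    by (force simp: step_gf_def)+
qed

lemma run_forward:
  assumes "s \<in> {1, -1}" "r \<in> {1, 2}" "(c, r) \<in> V" "(c, 3 - r) \<notin> V" "ahead_free V s c"
    "lane V s c (3 - r) k walled"
  shows "position t (insert (c + s, r) V) (c + s, r) (run_gf t walled (Suc k))"
    and "step_gf t V (c + s, r) = fps_X"
    and "(c + s, r) \<notin> V"
proof -
  have *: "ahead_free (insert (c + s, r) V) s (c + s)" "(c + s, 3 - r) \<notin> insert (c + s, r) V"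
    using assms by (auto simp: ahead_free_def)
  have "lane (insert (c + s, r) V) s (c + s) (3 - r) (Suc k) walled"
    unfolding lane_def
  proof (intro conjI allI impI; (split if_split)?; (intro conjI allI impI)?; (elim conjE)?)
    fix x
    assume x: "0 < s * (c + s - x)" "s * (c + s - x) \<le> int (Suc k)"
    have "x = c \<or> 0 < s * (c - x) \<and> s * (c - x) \<le> int k"
      using x assms(1) by auto
    then show "(x, 3 - r) \<notin> insert (c + s, r) V" "(x, 3 - (3 - r)) \<in> insert (c + s, r) V"
      using assms unfolding lane_def by auto
  next
    assume walled
    then show "(c + s - s * (int (Suc k) + 1), 3 - r) \<in> insert (c + s, r) V"
       "(c + s - s * (int (Suc k) + 1), 3 - (3 - r)) \<in> insert (c + s, r) V"
      using assms(6) by (simp_all add: lane_def algebra_simps)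
  next
    fix x \<rho>
    assume "\<not> walled" "int (Suc k) < s * (c + s - x)"
    then show "(x, \<rho>) \<notin> insert (c + s, r) V"
      using assms(1,6) by (auto simp: lane_def)
  qed
  from running[OF assms(1,2) _ *(2,1) this]
  show "position t (insert (c + s, r) V) (c + s, r) (run_gf t walled (Suc k))" by simp
  have "c + s \<notin> fst ` V" using assms(1,5) by (auto simp: ahead_free_def)
  then show "step_gf t V (c + s, r) = fps_X" "(c + s, r) \<notin> V"
    by (force simp: step_gf_def)+
qed

lemma run_vertical:
  assumes "s \<in> {1, -1}" "r \<in> {1, 2}" "(c, r) \<in> V" "(c, 3 - r) \<notin> V" "ahead_free V s c"
    "lane V s c (3 - r) k walled"
  shows "position t (insert (c, 3 - r) V) (c, 3 - r) (turn_gf t walled k)"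
    and "step_gf t V (c, 3 - r) = fps_X ^ t"
proof -
  have "ahead_free (insert (c, 3 - r) V) s c" "lane (insert (c, 3 - r) V) s c (3 - r) k walled"
    using assms(1,5,6) by (auto simp: ahead_free_def lane_def)
  then show "position t (insert (c, 3 - r) V) (c, 3 - r) (turn_gf t walled k)"
    using assms by (intro turning[of s]) auto
  show "step_gf t V (c, 3 - r) = fps_X ^ t"
    using assms by (force simp: step_gf_def)
qed

text \<open>
  Every step back costs \<open>b\<close> and shortens the lane by one, until an open lane is used up. The
  next step then enters a new column with a completely visited one at its back, which is a step
  forward in the direction \<open>- s\<close>.
\<close>

lemma retreat:
  assumes "s \<in> {1, -1}" "r \<in> {1, 2}" "(c, r) \<in> V" "(c, 3 - r) \<in> V"
    "lane V s c r k walled" "\<not> (walled \<and> k = 0)"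
  shows "\<exists>F. position t (insert (c - s, r) V) (c - s, r) F
           \<and> step_gf t V (c - s, r) * F = far_gf t walled * (fps_X ^ t) ^ k"
    and "(c - s, r) \<notin> V"
proof -
  show "(c - s, r) \<notin> V"
    using assms by (cases k) (auto simp: lane_def)
  show "\<exists>F. position t (insert (c - s, r) V) (c - s, r) F
           \<and> step_gf t V (c - s, r) * F = far_gf t walled * (fps_X ^ t) ^ k"
  proof (cases k)
    case 0
    with assms have "\<not> walled" by simp
    have "ahead_free V (- s) c"
      using assms(1,5) 0 \<open>\<not> walled\<close> by (auto simp: lane_def ahead_free_def)
    moreover have "- s \<in> {1, -1}" using assms(1) by auto
    ultimately have "position t (insert (c - s, r) V) (c - s, r) (corner_gf t)"
      "step_gf t V (c - s, r) = fps_X"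
      using turn_forward(1,2)[of "- s" r c V t] assms(2,3,4) by simp_all
    then show ?thesis
      using 0 \<open>\<not> walled\<close> by (intro exI[of _ "corner_gf t"]) (simp add: far_gf_def)
  next
    case (Suc m)
    let ?V = "insert (c - s, r) V"
    have old: "(c - s, 3 - r) \<in> V" using assms(1,5) Suc by (auto simp: lane_def)
    have "lane ?V s (c - s) r m walled"
      unfolding lane_def
    proof (intro conjI allI impI; (split if_split)?; (intro conjI allI impI)?; (elim conjE)?)
      fix x
      assume x: "0 < s * (c - s - x)" "s * (c - s - x) \<le> int m"
      then have "0 < s * (c - x) \<and> s * (c - x) \<le> int k" "x \<noteq> c - s"
        using assms(1) Suc by auto
      then show "(x, r) \<notin> ?V" "(x, 3 - r) \<in> ?V"
        using assms unfolding lane_def by auto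
    next
      assume walled
      then show "(c - s - s * (int m + 1), r) \<in> ?V" "(c - s - s * (int m + 1), 3 - r) \<in> ?V"
        using assms(5) Suc by (simp_all add: lane_def algebra_simps)
    next
      fix x \<rho>
      assume "\<not> walled" "int m < s * (c - s - x)"
      then show "(x, \<rho>) \<notin> ?V"
        using assms(1,5) Suc by (auto simp: lane_def)
    qed
    then have "position t ?V (c - s, r) (far_gf t walled * (fps_X ^ t) ^ m)"
      using assms old by (intro retreating[of s]) auto
    moreover have "step_gf t V (c - s, r) = fps_X ^ t"
      using old by (force simp: step_gf_def)
    ultimately show ?thesis using Suc by (auto simp: mult_ac)
  qed
qed

text \<open>
  The weight of the step is included in \<open>H\<close>, so that the one-step recursion becomes a plain sum
  over the unvisited neighbours.
\<close>

definition successor :: "nat \<Rightarrow> (int \<times> nat) set \<Rightarrow> int \<times> nat \<Rightarrow> real fps \<Rightarrow> bool" where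
  "successor t V v H \<longleftrightarrow> (\<exists>F. position t (insert v V) v F \<and> H = step_gf t V v * F)"

text \<open>
  In each situation the free neighbours are found, the situations that they lead to are
  identified, and the claim becomes the recursion of the closed form. Apart from the start there
  are at most two free neighbours, and facts \<open>two\<close> and \<open>one\<close> below deal with those cases; there is
  none exactly at the end of a walled lane.
\<close>

lemma position_closed:
  assumes "position t V u G"
  defines "U \<equiv> ladder_edges `` {u} - V"
  shows "if U = {} then G = 1
         else \<exists>h. of_nat (card U) * G = (\<Sum>v\<in>U. h v) \<and> (\<forall>v\<in>U. successor t V v (h v))"
proof -
  have two: ?thesis
    if "U = {a, b}" "a \<noteq> b" "successor t V a A" "successor t V b B" "2 * G = A + B" for a b A B
    using that by (auto intro!: exI[of _ "\<lambda>v. if v = a then A else B"])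
  have one: ?thesis if "U = {a}" "successor t V a G" for a
    using that by (auto intro!: exI[of _ "\<lambda>v. G"])
  from assms(1) show ?thesis
  proof cases
    case (starting r c)
    have c2: "(c, 3 - r) \<noteq> (c, r)" using starting by auto
    have R: "successor t {(c, r)} (c + s, r) (fps_X * run_gf t False 1)" if "s \<in> {1, -1}" for s
    proof -
      have "position t {(c + s, r), (c, r)} (c + s, r) (run_gf t False 1)"
        using starting that by (intro running[of s]) (auto simp: ahead_free_def lane_def)
      then show ?thesis using that by (auto simp: successor_def step_gf_def)
    qed
    have T: "successor t {(c, r)} (c, 3 - r) (fps_X ^ t * turn_gf t False 0)"
    proof -
      have "position t {(c, 3 - r), (c, r)} (c, 3 - r) (turn_gf t False 0)"
        using starting by (intro turning[of 1]) (auto simp: ahead_free_def lane_def)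
      then show ?thesis by (auto simp: successor_def step_gf_def)
    qed
    have turn0: "turn_gf t False 0 = fps_X * corner_gf t"
    proof -
      have "turn_gf t False 0 = fps_const (1 / 2) * (2 * (fps_X * corner_gf t))"
        unfolding mult_2 by (simp add: turn_gf_def far_gf_def)
      then show ?thesis by (simp only: mult.left_commute[of _ 2] two_half)
    qed
    have U: "U = {(c + 1, r), (c - 1, r), (c, 3 - r)}"
    proof -
      have "ladder_edges `` {(c, r)} = {(c + 1, r), (c - 1, r), (c, 3 - r)}"
        using starting by (intro ladder_nbrs) simp_all
      moreover have "(c, r) \<notin> {(c + 1, r), (c - 1, r), (c, 3 - r)}" using c2 by simp
      ultimately show ?thesis by (simp add: U_def starting(1,2))
    qed
    define h where "h v = (if fst v = c then fps_X ^ t * turn_gf t False 0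
      else fps_X * run_gf t False 1)" for v :: "int \<times> nat"
    have "of_nat (card U) * G = (\<Sum>v\<in>U. h v)"
      unfolding U using start_gf_rec[of t] by (simp add: h_def turn0 starting algebra_simps)
    moreover have "\<forall>v\<in>U. successor t V v (h v)"
      unfolding U using R[of 1] R[of "-1"] T by (auto simp: h_def starting)
    ultimately show ?thesis using U by auto
  next
    case (running s r c k walled)
    have "(c - s, r) \<in> V"
      using running by (cases "k = 0") (auto simp: lane_def)
    then have U: "U = {(c + s, r), (c, 3 - r)}"
      using ladder_nbrs[of s r c] running run_forward(3)[OF running(3-8)] unfolding U_def by auto
    show ?thesis
      using run_forward(1,2)[OF running(3-8), of t] run_vertical[OF running(3-8), of t]
        run_gf_rec[OF running(9), of t] running(3)
      by (intro two[OF U, of "fps_X * run_gf t walled (Suc k)" "fps_X ^ t * turn_gf t walled k"])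
         (auto simp: successor_def running)
  next
    case (turning s r c k walled)
    have fwd: "successor t V (c + s, r) (fps_X * corner_gf t)"
      using turn_forward(1,2)[OF turning(3-7), of t] by (auto simp: successor_def)
    show ?thesis
    proof (cases "walled \<and> k = 0")
      case True
      then have "(c - s, r) \<in> V" using turning by (auto simp: lane_def)
      then have U: "U = {(c + s, r)}"
        using ladder_nbrs[of s r c] turning turn_forward(3)[OF turning(3-7)] unfolding U_def by auto
      then show ?thesis using fwd True by (intro one) (auto simp: turn_gf_def turning(2))
    next
      case False
      have U: "U = {(c + s, r), (c - s, r)}"
        using ladder_nbrs[of s r c] turning turn_forward(3)[OF turning(3-7)]
          retreat(2)[OF turning(3-6,8) False] unfolding U_def by auto
      show ?thesis
        using fwd retreat(1)[OF turning(3-6,8) False, of t] turn_gf_rec[OF False, of t] turning(3)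
        by (intro two[OF U, of "fps_X * corner_gf t" "far_gf t walled * (fps_X ^ t) ^ k"])
           (auto simp: successor_def turning(2))
    qed
  next
    case (retreating s r c k walled)
    show ?thesis
    proof (cases "walled \<and> k = 0")
      case True
      then have "(c - s, r) \<in> V" using retreating by (auto simp: lane_def)
      then have "U = {}" using ladder_nbrs[of s r c] retreating unfolding U_def by auto
      then show ?thesis using True retreating(2) by (simp add: far_gf_def)
    next
      case False
      have U: "U = {(c - s, r)}"
        using ladder_nbrs[of s r c] retreating retreat(2)[OF retreating(3-6,8) False]
        unfolding U_def by auto
      then show ?thesis
        using retreat(1)[OF retreating(3-6,8) False, of t]
        by (intro one) (auto simp: successor_def retreating(2))
    qed
  qed
qed

section \<open>The generating functions\<close>

lemma ladder_walk_gf: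
  assumes "ladder_walk p" "position t (set p) (last p) G"
  shows "walk_gf ladder_edges (walk_weight t) p = fps_X ^ walk_weight t p * G"
proof -
  define R where "R p F \<longleftrightarrow> ladder_walk p \<and>
    (\<exists>G. position t (set p) (last p) G \<and> F = fps_X ^ walk_weight t p * G)" for p F
  show ?thesis
  proof (rule walk_gf_unique[where R = R and B = "\<lambda>n. 2 * n + 2"])
    show "R p (fps_X ^ walk_weight t p * G)" using assms by (auto simp: R_def)
  next
    fix p F assume "R p F" "unvisited ladder_edges p = {}"
    then show "F = fps_X ^ walk_weight t p"
      using position_closed[of t "set p" "last p"] by (auto simp: R_def unvisited_def)
  next
    fix p F q assume "R p F" "q \<in> set_spmf (gsaw_from ladder_edges p)"
    then have "ladder_walk q \<and> length p \<le> length q"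
      using gsaw_from_invariant[of "\<lambda>q. ladder_walk q \<and> length p \<le> length q" p ladder_edges]
      by (auto simp: R_def ladder_walk_snoc)
    then show "length p \<le> 2 * walk_weight t q + 2"
      using ladder_walk_length_le[of q t] by linarith
  next
    fix p F n assume "R p F" "2 * n + 2 < length p"
    then show "fps_nth F n = 0"
      using ladder_walk_length_le[of p t] by (auto simp: R_def fps_X_power_mult_nth)
  next
    fix p F assume R: "R p F" and ne: "unvisited ladder_edges p \<noteq> {}"
    let ?U = "unvisited ladder_edges p"
    from R obtain G where walk: "ladder_walk p" and G: "position t (set p) (last p) G"
      and F: "F = fps_X ^ walk_weight t p * G" by (auto simp: R_def)
    obtain h where h: "of_nat (card ?U) * G = (\<Sum>v\<in>?U. h v)"
      and succ: "\<And>v. v \<in> ?U \<Longrightarrow> successor t (set p) v (h v)"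
      using position_closed[OF G] ne by (auto simp: unvisited_def)
    have "last p \<in> ladder_verts" using walk by (force simp: ladder_walk_def dest: last_in_set)
    then have "finite (ladder_edges `` {last p})"
      using ladder_nbrs[of 1 "snd (last p)" "fst (last p)"] by (auto simp: ladder_verts_def)
    then have "finite ?U" by (simp add: unvisited_def)
    moreover have "of_nat (card ?U) * F = (\<Sum>v\<in>?U. fps_X ^ walk_weight t p * h v)"
      using h by (simp add: F sum_distrib_left [symmetric] mult.left_commute)
    moreover have "R (p @ [v]) (fps_X ^ walk_weight t p * h v)" if "v \<in> ?U" for v
    proof -
      from succ[OF that] obtain F' where "position t (insert v (set p)) v F'"
        "h v = step_gf t (set p) v * F'" by (auto simp: successor_def)
      moreover have "p \<noteq> []" using walk by (simp add: ladder_walk_def)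
      ultimately show ?thesis
        using ladder_walk_snoc[OF walk that]
        by (auto simp: R_def walk_weight_snoc step_gf_def power_add mult.assoc simp del: power_one_right)
    qed
    ultimately show "finite ?U \<and> (\<exists>g. of_nat (card ?U) * F = (\<Sum>v\<in>?U. g v) \<and>
      (\<forall>v\<in>?U. R (p @ [v]) (g v)))" by blast
  qed
qed

lemma ladder_gsaw_gf:
  assumes "v \<in> ladder_verts"
  shows "Abs_fps (\<lambda>n. measure (measure_spmf (gsaw ladder_edges v)) {p. walk_weight t p = n})
         = start_gf t"
proof -
  obtain c r where v: "v = (c, r)" "r \<in> {1, 2}" using assms by (auto simp: ladder_verts_def)
  have "ladder_walk [v]" using assms by (simp add: ladder_walk_singleton)
  moreover have "position t (set [v]) (last [v]) (start_gf t)" using v starting by simp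
  ultimately have "walk_gf ladder_edges (walk_weight t) [v] = start_gf t"
    by (simp add: ladder_walk_gf walk_weight_def)
  then show ?thesis
    by (simp add: walk_gf_def gsaw_def spmf_map vimage_def)
qed

lemma measure_gsaw_cong:
  assumes "v \<in> ladder_verts" "\<And>p. ladder_walk p \<Longrightarrow> P p \<longleftrightarrow> Q p"
  shows "measure (measure_spmf (gsaw ladder_edges v)) {p. P p}
         = measure (measure_spmf (gsaw ladder_edges v)) {p. Q p}"
proof -
  have "ladder_walk [v]" using assms by (simp add: ladder_walk_singleton)
  then have "\<forall>q\<in>set_spmf (gsaw ladder_edges v). ladder_walk q"
    unfolding gsaw_def by (rule gsaw_from_invariant) (rule ladder_walk_snoc)
  then show ?thesis
    using assms(2) by (intro measure_spmf.finite_measure_eq_AE) auto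
qed

lemma start_equation:
  fixes b x :: "'a::idom"
  assumes u: "u*(4-2*x) = 1" and w: "w*(4-2*x*b) = 1" and z: "z*Z = 1"
    and c: "c = 2*x*b^2*(2-x)*w*z"
    and s: "3 * s = b*x*c + 2*(x*(b*(x*c*u + x*c*b*w)))"
  shows "s*(3*(x*b-2)^2*Z) = x^2*b^3*(4-x^2*b)"
proof -
  have "c*u = x*b^2*w*z*(u*(4-2*x))" unfolding c by (simp add: algebra_simps)
  then have cu: "c*u = x*b^2*w*z" using u by simp
  have "3 * s = b*x*c*(1+2*x*b*w) + 2*x^2*b*(c*u)"
    unfolding s by (simp add: algebra_simps power2_eq_square)
  also have "1 + 2*x*b*w = 4*w" using w by (simp add: algebra_simps)
  also have "b*x*c*(4*w) + 2*x^2*b*(c*u) = w*z*x^2*b^3*(8*(2-x)*w + 2*x)"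
    unfolding cu unfolding c by (simp add: algebra_simps power2_eq_square power3_eq_cube)
  also have "2*x = 2*x*(w*(4-2*x*b))" using w by simp
  also have "w*z*x^2*b^3*(8*(2-x)*w + 2*x*(w*(4-2*x*b))) = 4*(w^2*z*x^2*b^3*(4-x^2*b))"
    by (simp add: algebra_simps power2_eq_square power3_eq_cube)
  finally have s3: "3 * s = 4*(w^2*z*x^2*b^3*(4-x^2*b))" .
  have "s*(3*(x*b-2)^2*Z) = (3 * s) * (x*b-2)^2*Z" by (simp add: algebra_simps)
  also have "\<dots> = (w*(4-2*x*b))^2*(z*Z)*(x^2*b^3*(4-x^2*b))"
    unfolding s3 by (simp add: algebra_simps power2_eq_square)
  finally show ?thesis using w z by simp
qed

lemma start_gf_closed:
  "start_gf t * (3 * (fps_X * fps_X ^ t - 2) ^ 2 * denom_gf t)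
   = fps_X ^ 2 * (fps_X ^ t) ^ 3 * (4 - fps_X ^ 2 * fps_X ^ t)"
proof -
  have "3 * start_gf t = fps_X ^ t * fps_X * corner_gf t + 2 * (fps_X * (fps_X ^ t *
      (fps_X * corner_gf t * inverse (4 - 2 * fps_X)
       + fps_X * corner_gf t * fps_X ^ t * inverse (4 - 2 * fps_X * fps_X ^ t))))"
    unfolding start_gf_rec by (simp add: run_gf_def far_gf_def)
  then show ?thesis
    by (rule start_equation[OF denominator_inverses corner_gf_def])
qed

lemma fps_divide_eqI:
  fixes F N D :: "real fps"
  assumes "F * D = N" "fps_nth D 0 \<noteq> 0"
  shows "F = N / D"
  using assms by (metis fps_zero_nth nonzero_mult_div_cancel_right)

theorem corollary2p21:
  fixes v :: "int \<times> nat"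
  assumes "v \<in> ladder_verts"
  shows "Abs_fps (length_prob v) =
           fps_X ^ 5 * (4 - fps_X ^ 3) /
           (3 * (fps_X ^ 2 - 2) ^ 2 * (fps_X ^ 3 - 4 * fps_X ^ 2 - 4 * fps_X + 8)) \<and>
         Abs_fps (width_prob v) =
           fps_X ^ 2 * (4 - fps_X ^ 2) /
           (3 * (fps_X - 2) ^ 2 * (fps_X ^ 2 - 8 * fps_X + 8))"
proof
  have "length_prob v =
      (\<lambda>l. measure (measure_spmf (gsaw ladder_edges v)) {p. walk_weight 1 p = l})"
    unfolding length_prob_def by (intro ext measure_gsaw_cong assms) (simp add: walk_weight_1)
  then have eq: "Abs_fps (length_prob v) = start_gf 1" by (simp add: ladder_gsaw_gf[OF assms])
  have num: "fps_X ^ 5 * (4 - fps_X ^ 3) = (fps_X ^ 2 * fps_X ^ 3 * (4 - fps_X ^ 2 * fps_X) :: real fps)"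
    by (simp add: algebra_simps eval_nat_numeral)
  have den: "fps_X ^ 3 - 4 * fps_X ^ 2 - 4 * fps_X + 8 = denom_gf 1"
    by (simp add: denom_gf_def eval_nat_numeral)
  show "Abs_fps (length_prob v) =
           fps_X ^ 5 * (4 - fps_X ^ 3) /
           (3 * (fps_X ^ 2 - 2) ^ 2 * (fps_X ^ 3 - 4 * fps_X ^ 2 - 4 * fps_X + 8))"
    unfolding eq num den
    using start_gf_closed[of 1]
    by (intro fps_divide_eqI) (simp_all add: power2_eq_square denom_gf_def fps_numeral_nth)
next
  have "width_prob v =
      (\<lambda>w. measure (measure_spmf (gsaw ladder_edges v)) {p. walk_weight 0 p = w})"
    unfolding width_prob_def by (intro ext measure_gsaw_cong assms) (simp add: walk_weight_0)
  then have eq: "Abs_fps (width_prob v) = start_gf 0" by (simp add: ladder_gsaw_gf[OF assms])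
  have den: "fps_X ^ 2 - 8 * fps_X + 8 = denom_gf 0"
    by (simp add: denom_gf_def)
  show "Abs_fps (width_prob v) =
           fps_X ^ 2 * (4 - fps_X ^ 2) /
           (3 * (fps_X - 2) ^ 2 * (fps_X ^ 2 - 8 * fps_X + 8))"
    unfolding eq den
    using start_gf_closed[of 0]
    by (intro fps_divide_eqI) (simp_all add: power2_eq_square denom_gf_def fps_numeral_nth)
qed

end
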